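(* Consider the noiseless ternary remotely powered channel with $\mathcal X=\mathcal Y=\{0,1,2\}$, $Y_t=X_t$, $\phi(x)=x$, battery capacity $\bar B=2$ and energy alphabet $\mathcal E=\{0,2\}$. Its capacity $C_\emptyset(\Gamma)$ with a generic charger (no side information) is as follows. For any $0<\Gamma\le2$ with $\Gamma=\frac2\ell$ for some integer $\ell\ge1$, $$C_\emptyset(\Gamma)=\frac\Gamma2\log\frac{(\Gamma+1)(\Gamma+2)}{\Gamma^2}.$$ For all other $0<\Gamma\le2$, with $\Gamma_1=\frac{2}{\lceil2/\Gamma\rceil}$, $\Gamma_2=\frac{2}{\lfloor2/\Gamma\rfloor}$ and $\alpha=\frac{\Gamma_2-\Gamma}{\Gamma_2-\Gamma_1}$, $$C_\emptyset(\Gamma)=\alpha C_\emptyset(\Gamma_1)+(1-\alpha)C_\emptyset(\Gamma_2).$$ Moreover $C_\emptyset(0)=0$ and $C_\emptyset(\Gamma)=\log3$ for $\Gamma>2$.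
   Context: Logarithms are to base 2. The battery level satisfies $B_1=\bar B=2$ and $B_{t+1}=\min\{B_t+E_t,\bar B\}-X_t$; the input must satisfy $X_t\le\min\{B_t+E_t,\bar B\}$, where $E_t\in\mathcal E$ is the energy sent by the charger at time $t$. The charging sequence must satisfy $\frac1n\sum_{t=1}^nE_t\le\Gamma$. An $(R,n)$ code with generic charger consists of a fixed deterministic charging sequence $e^n\in\mathcal E^n$ satisfying the cost constraint, a message set $\mathcal M=\{1,\dots,2^{nR}\}$ (rounded to an integer), transmitter functions $x_t=f_t^{\mathrm{Tx}}(m,e^t)\in\mathcal X$ satisfying the energy constraints, and a decoder $\mathcal Y^n\to\mathcal M$ giving $\hat M$. The error probability is $P_e=|\mathcal M|^{-1}\sum_m\Pr(\hat M\ne m\mid m\text{ sent})$; $R$ is achievable if there is a sequence of $(R,n)$ codes with $P_e\to0$; $C_\emptyset(\Gamma)$ is the supremum of achievable rates. *)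

theory Defs
  imports "HOL-Probability.Product_PMF"
begin

text \<open>
  Remotely powered memoryless channel: \<open>law x\<close> is the distribution of the output given input \<open>x\<close>,
  \<open>energy x\<close> the energy consumed by sending \<open>x\<close>, and \<open>charges\<close> the alphabet of the charger.
\<close>

record ('x, 'y) rp_channel =
  inputs :: "'x set"
  outputs :: "'y set"
  law :: "'x \<Rightarrow> 'y pmf"
  energy :: "'x \<Rightarrow> real"
  battery_size :: real
  charges :: "real set"

text \<open>
  Time starts at 1, and sequences are functions on \<open>nat\<close> read on \<open>{1..n}\<close> only; the value at
  time 0 is a dummy.
\<close>

fun battery :: "('x, 'y) rp_channel \<Rightarrow> (nat \<Rightarrow> real) \<Rightarrow> (nat \<Rightarrow> 'x) \<Rightarrow> nat \<Rightarrow> real" where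
  "battery c e x 0 = battery_size c"
| "battery c e x (Suc 0) = battery_size c"
| "battery c e x (Suc (Suc t)) =
     min (battery c e x (Suc t) + e (Suc t)) (battery_size c) - energy c (x (Suc t))"

definition prefix_list :: "(nat \<Rightarrow> 'a) \<Rightarrow> nat \<Rightarrow> 'a list" where
  "prefix_list s t = map s [1..<Suc t]"

definition messages :: "real \<Rightarrow> nat \<Rightarrow> nat set" where
  "messages R n = {1..nat \<lfloor>2 powr (real n * R)\<rfloor>}"

definition codeword ::
    "(nat \<Rightarrow> nat \<Rightarrow> real list \<Rightarrow> 'x) \<Rightarrow> (nat \<Rightarrow> real) \<Rightarrow> nat \<Rightarrow> nat \<Rightarrow> 'x" where
  "codeword f e m t = f t m (prefix_list e t)"

definition generic_charger_code ::
    "('x, 'y) rp_channel \<Rightarrow> real \<Rightarrow> real \<Rightarrow> nat \<Rightarrow> (nat \<Rightarrow> real) \<Rightarrow>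
     (nat \<Rightarrow> nat \<Rightarrow> real list \<Rightarrow> 'x) \<Rightarrow> ('y list \<Rightarrow> nat) \<Rightarrow> bool" where
  "generic_charger_code c \<Gamma> R n e f dec \<longleftrightarrow>
     (\<forall>t\<in>{1..n}. e t \<in> charges c) \<and>
     (1 / real n) * (\<Sum>t=1..n. e t) \<le> \<Gamma> \<and>
     (\<forall>t\<in>{1..n}. \<forall>m\<in>messages R n. \<forall>es.
        length es = t \<and> set es \<subseteq> charges c \<longrightarrow> f t m es \<in> inputs c) \<and>
     (\<forall>m\<in>messages R n. \<forall>t\<in>{1..n}.
        energy c (codeword f e m t)
          \<le> min (battery c e (codeword f e m) t + e t) (battery_size c)) \<and>
     (\<forall>ys. length ys = n \<and> set ys \<subseteq> outputs c \<longrightarrow> dec ys \<in> messages R n)"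

text \<open>
  There is no feedback, so given the message and the charging sequence the outputs are independent.
\<close>

definition message_error_prob ::
    "('x, 'y) rp_channel \<Rightarrow> nat \<Rightarrow> (nat \<Rightarrow> real) \<Rightarrow>
     (nat \<Rightarrow> nat \<Rightarrow> real list \<Rightarrow> 'x) \<Rightarrow> ('y list \<Rightarrow> nat) \<Rightarrow> nat \<Rightarrow> real" where
  "message_error_prob c n e f dec m =
     measure_pmf.prob (Pi_pmf {1..n} undefined (\<lambda>t. law c (codeword f e m t)))
       {y. dec (prefix_list y n) \<noteq> m}"

definition error_prob ::
    "('x, 'y) rp_channel \<Rightarrow> real \<Rightarrow> nat \<Rightarrow> (nat \<Rightarrow> real) \<Rightarrow>
     (nat \<Rightarrow> nat \<Rightarrow> real list \<Rightarrow> 'x) \<Rightarrow> ('y list \<Rightarrow> nat) \<Rightarrow> real" where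
  "error_prob c R n e f dec =
     (\<Sum>m\<in>messages R n. message_error_prob c n e f dec m) / real (card (messages R n))"

definition generic_achievable :: "('x, 'y) rp_channel \<Rightarrow> real \<Rightarrow> real \<Rightarrow> bool" where
  "generic_achievable c \<Gamma> R \<longleftrightarrow> R \<ge> 0 \<and>
     (\<exists>e f dec.
        (\<forall>n\<ge>1. generic_charger_code c \<Gamma> R n (e n) (f n) (dec n)) \<and>
        (\<lambda>n. error_prob c R n (e n) (f n) (dec n)) \<longlonglongrightarrow> 0)"

text \<open>
  The supremum is taken in the reals, so it is meaningful only if some rate is achievable and the
  achievable rates are bounded, as they are for the channel below when \<open>\<Gamma> \<ge> 0\<close>.
\<close>

definition generic_capacity :: "('x, 'y) rp_channel \<Rightarrow> real \<Rightarrow> real" where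
  "generic_capacity c \<Gamma> = Sup {R. generic_achievable c \<Gamma> R}"

definition noiseless_ternary :: "(nat, nat) rp_channel" where
  "noiseless_ternary =
     \<lparr>inputs = {0, 1, 2}, outputs = {0, 1, 2}, law = return_pmf, energy = real,
      battery_size = 2, charges = {0, 2}\<rparr>"

end

theory Submission
  imports Defs
begin

text \<open>
  Every charge refills the battery, so between two charges the transmitter sends a ternary word of
  weight at most 2; there are \<open>N j = (j + 1) (j + 2) / 2\<close> of them of length \<open>j\<close>. A charging
  sequence therefore admits exactly \<open>\<Prod> N j\<close> words, the product being over the gap lengths. As the
  channel is noiseless, the capacity is the best growth rate of this product for \<open>n \<Gamma> / 2\<close>
  charges in time \<open>n\<close>. The function \<open>log N\<close> is concave on the naturals, hence lies below each line
  through two consecutive points of its graph, and summing this bound over the gaps gives the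
  converse. Equality holds when all gaps have one of the two consecutive lengths, which is
  achieved by concatenating blocks of these lengths.
\<close>

section \<open>Counting the words that a charging sequence admits\<close>

text \<open>The number of ternary words of length \<open>j\<close> and weight at most 2.\<close>

definition block_words :: "nat \<Rightarrow> nat" where
  "block_words j = (j + 2) choose 2"

lemma block_words_0 [simp]: "block_words 0 = 1"
  by (simp add: block_words_def numeral_2_eq_2)

lemma block_words_Suc [simp]: "block_words (Suc j) = block_words j + j + 2"
  by (simp add: block_words_def numeral_2_eq_2)

lemma block_words_real: "real (block_words j) = (real j + 1) * (real j + 2) / 2"
proof -
  have "2 * real (block_words j) = (real j + 1) * (real j + 2)"
    by (induction j) (simp_all add: algebra_simps)
  then show ?thesis by simp
qed

lemma block_words_pos: "block_words j > 0"
  by (induction j) auto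

text \<open>
  \<open>age\<close> counts the slots since the last charge, including the charged one; \<open>settled_words\<close> is
  the number of choices for everything before it.
\<close>

fun age :: "(nat \<Rightarrow> real) \<Rightarrow> nat \<Rightarrow> nat" where
  "age e 0 = 0"
| "age e (Suc n) = (if e (Suc n) = 2 then 1 else Suc (age e n))"

fun settled_words :: "(nat \<Rightarrow> real) \<Rightarrow> nat \<Rightarrow> nat" where
  "settled_words e 0 = 1"
| "settled_words e (Suc n) =
     (if e (Suc n) = 2 then settled_words e n * block_words (age e n) else settled_words e n)"

definition word_count :: "(nat \<Rightarrow> real) \<Rightarrow> nat \<Rightarrow> nat" where
  "word_count e n = settled_words e n * block_words (age e n)"

text \<open>Here \<open>b\<close> is the battery level left after the word has been sent.\<close>

fun words_at_level :: "(nat \<Rightarrow> real) \<Rightarrow> nat \<Rightarrow> nat \<Rightarrow> nat list set" where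
  "words_at_level e 0 b = (if b = 2 then {[]} else {})"
| "words_at_level e (Suc n) b =
     {xs @ [x] | xs x b'. b' \<le> 2 \<and> xs \<in> words_at_level e n b' \<and>
        x + b = (if e (Suc n) = 2 then 2 else b')}"

definition feasible_words :: "(nat \<Rightarrow> real) \<Rightarrow> nat \<Rightarrow> nat list set" where
  "feasible_words e n = (\<Union>b\<le>2. words_at_level e n b)"

declare words_at_level.simps(2) [simp del]

lemma atMost_2: "{..2::nat} = {0, 1, 2}"
  by auto

lemma words_at_level_SucE:
  assumes "xs \<in> words_at_level e (Suc n) b"
  obtains ys x b' where "xs = ys @ [x]" "b' \<le> 2" "ys \<in> words_at_level e n b'"
    "x + b = (if e (Suc n) = 2 then 2 else b')"
  using assms unfolding words_at_level.simps(2) by blast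

lemma words_at_level_bounds:
  "xs \<in> words_at_level e n b \<Longrightarrow> b \<le> 2 \<and> length xs = n \<and> set xs \<subseteq> {0, 1, 2}"
proof (induction n arbitrary: xs b)
  case 0
  then show ?case by (simp split: if_splits)
next
  case (Suc n)
  from Suc.prems show ?case
  proof (rule words_at_level_SucE)
    fix ys x b'
    assume *: "xs = ys @ [x]" "b' \<le> 2" "ys \<in> words_at_level e n b'"
      "x + b = (if e (Suc n) = 2 then 2 else b')"
    then have "b \<le> 2" "x \<in> {..2}" by (auto split: if_splits)
    with Suc.IH[OF *(3)] *(1) show ?thesis unfolding atMost_2 by simp
  qed
qed

lemma words_at_level_SucI:
  assumes "ys \<in> words_at_level e n b'" "x + b = (if e (Suc n) = 2 then 2 else b')"
  shows "ys @ [x] \<in> words_at_level e (Suc n) b"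
  using assms words_at_level_bounds[OF assms(1)] unfolding words_at_level.simps(2) by blast

lemma finite_words_at_level: "finite (words_at_level e n b)"
  by (rule finite_subset[of _ "{xs. set xs \<subseteq> {0, 1, 2} \<and> length xs = n}"])
     (use words_at_level_bounds in blast, rule finite_lists_length_eq, simp)

text \<open>A word and the charges determine the level that is left. Hence the union over the levels
  is disjoint and the cardinalities add up.\<close>

lemma words_at_level_disjoint:
  "xs \<in> words_at_level e n b \<Longrightarrow> xs \<in> words_at_level e n b' \<Longrightarrow> b = b'"
proof (induction n arbitrary: xs b b')
  case 0
  then show ?case by (simp split: if_splits)
next
  case (Suc n)
  from Suc.prems(1) obtain ys x c where 1: "xs = ys @ [x]" "ys \<in> words_at_level e n c"
    "x + b = (if e (Suc n) = 2 then 2 else c)" by (rule words_at_level_SucE)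
  from Suc.prems(2) obtain ys' x' c' where 2: "xs = ys' @ [x']" "ys' \<in> words_at_level e n c'"
    "x' + b' = (if e (Suc n) = 2 then 2 else c')" by (rule words_at_level_SucE)
  have "ys' = ys" "x' = x" using 1(1) 2(1) by simp_all
  with Suc.IH[of ys c c'] 1 2 show ?case by (simp split: if_splits)
qed

lemma card_feasible_words_levels:
  "card (feasible_words e n) =
     card (words_at_level e n 0) + card (words_at_level e n 1) + card (words_at_level e n 2)"
proof -
  have "card (feasible_words e n) = (\<Sum>b\<le>2. card (words_at_level e n b))"
    unfolding feasible_words_def
    by (rule card_UN_disjoint) (use finite_words_at_level words_at_level_disjoint in blast)+
  then show ?thesis by (simp add: atMost_2)
qed

text \<open>The charge fills the battery whatever was left, so any feasible prefix may precede, and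
  the last letter is forced.\<close>

lemma words_at_level_charge:
  assumes "e (Suc n) = 2" "b \<le> 2"
  shows "words_at_level e (Suc n) b = (\<lambda>xs. xs @ [2 - b]) ` feasible_words e n"
proof (intro set_eqI iffI)
  fix xs assume "xs \<in> words_at_level e (Suc n) b"
  then obtain ys x b' where "xs = ys @ [x]" "b' \<le> 2" "ys \<in> words_at_level e n b'" "x = 2 - b"
    using assms by (elim words_at_level_SucE) simp
  then show "xs \<in> (\<lambda>xs. xs @ [2 - b]) ` feasible_words e n"
    unfolding feasible_words_def by blast
next
  fix xs assume "xs \<in> (\<lambda>xs. xs @ [2 - b]) ` feasible_words e n"
  then obtain ys b' where "xs = ys @ [2 - b]" "ys \<in> words_at_level e n b'"
    unfolding feasible_words_def by blast
  then show "xs \<in> words_at_level e (Suc n) b"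
    using assms by (auto intro: words_at_level_SucI)
qed

lemma card_words_at_level_charge:
  assumes "e (Suc n) = 2" "b \<le> 2"
  shows "card (words_at_level e (Suc n) b) = card (feasible_words e n)"
  unfolding words_at_level_charge[of e n b, OF assms] by (rule card_image) (auto simp: inj_on_def)

lemma words_at_level_idle:
  assumes "e (Suc n) \<noteq> 2"
  shows "words_at_level e (Suc n) b = (\<Union>b'\<in>{b..2}. (\<lambda>xs. xs @ [b' - b]) ` words_at_level e n b')"
proof (intro set_eqI iffI)
  fix xs assume "xs \<in> words_at_level e (Suc n) b"
  then obtain ys x b' where "xs = ys @ [x]" "b' \<le> 2" "ys \<in> words_at_level e n b'" "x + b = b'"
    using assms by (elim words_at_level_SucE) simp
  then have "xs = ys @ [b' - b]" "b' \<in> {b..2}" by auto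
  with \<open>ys \<in> _\<close> show "xs \<in> (\<Union>b'\<in>{b..2}. (\<lambda>xs. xs @ [b' - b]) ` words_at_level e n b')"
    by blast
next
  fix xs assume "xs \<in> (\<Union>b'\<in>{b..2}. (\<lambda>xs. xs @ [b' - b]) ` words_at_level e n b')"
  then obtain ys b' where "xs = ys @ [b' - b]" "ys \<in> words_at_level e n b'" "b \<le> b'"
    by auto
  then show "xs \<in> words_at_level e (Suc n) b"
    using assms by (auto intro: words_at_level_SucI)
qed

lemma card_words_at_level_idle:
  assumes "e (Suc n) \<noteq> 2"
  shows "card (words_at_level e (Suc n) b) = (\<Sum>b'\<in>{b..2}. card (words_at_level e n b'))"
proof -
  have "card (words_at_level e (Suc n) b) =
      (\<Sum>b'\<in>{b..2}. card ((\<lambda>xs. xs @ [b' - b]) ` words_at_level e n b'))"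
    unfolding words_at_level_idle[of e n b, OF assms]
    by (rule card_UN_disjoint) (use finite_words_at_level words_at_level_disjoint in auto)
  also have "\<dots> = (\<Sum>b'\<in>{b..2}. card (words_at_level e n b'))"
    by (intro sum.cong refl card_image) (auto simp: inj_on_def)
  finally show ?thesis .
qed

text \<open>Level 2 means that only zeros were sent since the last charge (or since the start),
  level 1 that exactly one of these \<open>age e n\<close> slots carried a 1. Level 0 is handled
  through the total: one slot later it has as many words as are feasible now.\<close>

lemma card_words_at_level:
  "card (words_at_level e n 2) = settled_words e n \<and>
   card (words_at_level e n 1) = settled_words e n * age e n \<and>
   card (feasible_words e n) = word_count e n"
proof (induction n)
  case 0
  then show ?case by (simp add: card_feasible_words_levels word_count_def)
next
  case (Suc n)
  show ?case
  proof (cases "e (Suc n) = 2")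
    case True
    then have "card (words_at_level e (Suc n) b) = word_count e n" if "b \<le> 2" for b
      using Suc card_words_at_level_charge[of e n b] that by simp
    from this[of 0] this[of 1] this[of 2] show ?thesis using True
      unfolding card_feasible_words_levels
      by (simp add: word_count_def)
  next
    case False
    have "{0..2} = {0, 1, 2::nat}" "{1..2} = {1, 2::nat}" by auto
    then have *: "card (words_at_level e (Suc n) 0) = card (feasible_words e n)"
      "card (words_at_level e (Suc n) 1) = card (words_at_level e n 1) + card (words_at_level e n 2)"
      "card (words_at_level e (Suc n) 2) = card (words_at_level e n 2)"
      using card_words_at_level_idle[of e n, OF False]
      by (simp_all add: card_feasible_words_levels)
    show ?thesis using Suc False
      unfolding card_feasible_words_levels[of e "Suc n"] *
      by (simp add: word_count_def algebra_simps)
  qed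
qed

lemmas card_feasible_words = card_words_at_level[THEN conjunct2, THEN conjunct2]

lemma finite_feasible_words: "finite (feasible_words e n)"
  by (simp add: feasible_words_def finite_words_at_level)

section \<open>The battery constraint in terms of feasible words\<close>

lemma prefix_list_0 [simp]: "prefix_list s 0 = []"
  by (simp add: prefix_list_def)

lemma prefix_list_Suc [simp]: "prefix_list s (Suc n) = prefix_list s n @ [s (Suc n)]"
  by (simp add: prefix_list_def)

lemma prefix_list_nth:
  assumes "length xs = n"
  shows "prefix_list (\<lambda>t. xs ! (t - 1)) n = xs"
  using assms by (intro nth_equalityI) (simp_all add: prefix_list_def del: upt_Suc)

lemma noiseless_ternary_simps [simp]:
  "inputs noiseless_ternary = {0, 1, 2}" "outputs noiseless_ternary = {0, 1, 2}"
  "law noiseless_ternary = return_pmf" "energy noiseless_ternary = real"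
  "battery_size noiseless_ternary = 2" "charges noiseless_ternary = {0, 2}"
  by (simp_all add: noiseless_ternary_def)

text \<open>Transfers the real-valued battery to the levels 0, 1, 2: charges are 0 or 2, letters are
  integers, and the constraint keeps the level nonnegative.\<close>

lemma battery_level:
  assumes "\<And>t. t \<in> {1..n} \<Longrightarrow> e t \<in> {0, 2}"
    and "\<And>t. t \<in> {1..n} \<Longrightarrow> real (x t) \<le> min (battery noiseless_ternary e x t + e t) 2"
  shows "\<exists>b\<le>2. battery noiseless_ternary e x (Suc n) = real b"
  using assms
proof (induction n)
  case 0
  then show ?case by (intro exI[of _ 2]) simp
next
  case (Suc n)
  then obtain b where b: "b \<le> 2" "battery noiseless_ternary e x (Suc n) = real b" by force
  have e: "e (Suc n) = 0 \<or> e (Suc n) = 2" using Suc.prems(1)[of "Suc n"] by auto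
  then have "min (real b + e (Suc n)) 2 = real (if e (Suc n) = 2 then 2 else b)"
    using b(1) by (auto simp: min_def)
  with Suc.prems(2)[of "Suc n"] b show ?case
    by (intro exI[of _ "(if e (Suc n) = 2 then 2 else b) - x (Suc n)"]) (auto split: if_splits)
qed

text \<open>The battery at \<open>Suc n\<close> is the level before slot \<open>Suc n\<close>, that
  is, the one left after slot \<open>n\<close>; hence the shift in the index.\<close>

lemma words_at_level_iff:
  assumes "\<And>t. t \<in> {1..n} \<Longrightarrow> e t \<in> {0, 2}"
  shows "prefix_list x n \<in> words_at_level e n b \<longleftrightarrow>
     (\<forall>t\<in>{1..n}. real (x t) \<le> min (battery noiseless_ternary e x t + e t) 2) \<and>
     battery noiseless_ternary e x (Suc n) = real b"
  using assms
proof (induction n arbitrary: b)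
  case 0
  then show ?case by auto
next
  case (Suc n)
  let ?B = "battery noiseless_ternary e x"
  let ?ok = "\<lambda>n. \<forall>t\<in>{1..n}. real (x t) \<le> min (?B t + e t) 2"
  have IH: "prefix_list x n \<in> words_at_level e n b' \<longleftrightarrow> ?ok n \<and> ?B (Suc n) = real b'" for b'
    using Suc by auto
  have e: "e (Suc n) = 0 \<or> e (Suc n) = 2" using Suc.prems[of "Suc n"] by auto
  have ok: "?ok (Suc n) \<longleftrightarrow> ?ok n \<and> real (x (Suc n)) \<le> min (?B (Suc n) + e (Suc n)) 2"
    by (auto simp: atLeastAtMostSuc_conv)
  show ?case
  proof (cases "?ok n")
    case True
    then obtain b' where b': "b' \<le> 2" "?B (Suc n) = real b'"
      using battery_level[of n e x] Suc.prems by auto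
    define c where "c = (if e (Suc n) = 2 then 2 else b')"
    have c: "min (?B (Suc n) + e (Suc n)) 2 = real c"
      using e b' by (auto simp: min_def c_def)
    have "prefix_list x (Suc n) \<in> words_at_level e (Suc n) b \<longleftrightarrow> x (Suc n) + b = c"
      using IH True b' by (auto simp: words_at_level.simps(2) c_def)
    \<comment> \<open>One equation in the naturals encodes both the energy constraint in the last
      slot and the level after it.\<close>
    moreover have "x (Suc n) + b = c \<longleftrightarrow> real (x (Suc n)) \<le> real c \<and> real c - real (x (Suc n)) = real b"
      by linarith
    moreover have "?B (Suc (Suc n)) = real c - real (x (Suc n))" using c by simp
    ultimately show ?thesis unfolding ok c using True by simp
  next
    case False
    then show ?thesis using IH ok by (auto simp: words_at_level.simps(2))
  qed
qed

lemma feasible_words_iff: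
  assumes "\<And>t. t \<in> {1..n} \<Longrightarrow> e t \<in> {0, 2}"
  shows "prefix_list x n \<in> feasible_words e n \<longleftrightarrow>
     (\<forall>t\<in>{1..n}. real (x t) \<le> min (battery noiseless_ternary e x t + e t) 2)"
  using battery_level[of n e x] words_at_level_iff[of n e x] assms
  by (auto simp: feasible_words_def)

section \<open>Codes for the noiseless channel\<close>

lemma message_error_prob_noiseless:
  "message_error_prob noiseless_ternary n e f dec m =
     of_bool (dec (prefix_list (codeword f e m) n) \<noteq> m)"
proof -
  \<comment> \<open>\<open>Pi_pmf\<close> yields \<open>undefined\<close> outside
    \<open>{1..n}\<close>, but \<open>prefix_list\<close> reads only inside. The output is thus
    surely the codeword, and the error probability is 0 or 1.\<close>
  have *: "prefix_list (\<lambda>t. if t \<in> {1..n} then codeword f e m t else undefined) n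
      = prefix_list (codeword f e m) n"
    by (auto simp: prefix_list_def)
  have "Pi_pmf {1..n} undefined (\<lambda>t. return_pmf (codeword f e m t)) =
      return_pmf (\<lambda>t. if t \<in> {1..n} then codeword f e m t else undefined)"
    by (rule Pi_pmf_return_pmf) simp
  then show ?thesis
    unfolding message_error_prob_def using * by (simp add: indicator_def)
qed

lemma card_messages: "card (messages R n) = nat \<lfloor>2 powr (real n * R)\<rfloor>"
  by (simp add: messages_def)

lemma card_messages_pos: "R \<ge> 0 \<Longrightarrow> card (messages R n) \<ge> 1"
  unfolding card_messages by (simp add: le_nat_iff le_floor_iff ge_one_powr_ge_zero)

lemma card_messages_le: "real (card (messages R n)) \<le> 2 powr (real n * R)"
  unfolding card_messages by simp

text \<open>Rounding down loses less than one message and at least one is left, so the loss is at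
  most a factor 2.\<close>

lemma card_messages_ge:
  assumes "R \<ge> 0"
  shows "2 powr (real n * R) \<le> 2 * real (card (messages R n))"
proof -
  have "2 powr (real n * R) \<le> real (card (messages R n)) + 1"
    unfolding card_messages by linarith
  with card_messages_pos[OF assms, of n] show ?thesis by linarith
qed

text \<open>The mean error times the number of messages counts the wrongly decoded ones. The others
  have distinct words, as \<open>dec\<close> inverts the encoding on them, and all these words are
  feasible.\<close>

lemma successful_messages_le:
  assumes code: "generic_charger_code noiseless_ternary \<Gamma> R n e f dec"
    and "R \<ge> 0"
  shows "(1 - error_prob noiseless_ternary R n e f dec) * real (card (messages R n))
     \<le> real (word_count e n)"
proof -
  let ?w = "\<lambda>m. prefix_list (codeword f e m) n"
  let ?M = "messages R n"
  define good where "good = {m \<in> ?M. dec (?w m) = m}"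
  have fin: "finite ?M" by (simp add: messages_def)
  have e: "e t \<in> {0, 2}" if "t \<in> {1..n}" for t
    using code that by (auto simp: generic_charger_code_def)
  have "?w ` good \<subseteq> feasible_words e n"
    using code feasible_words_iff[of n e, OF e]
    by (auto simp: good_def generic_charger_code_def)
  moreover have "inj_on ?w good"
    by (rule inj_on_inverseI[of _ dec]) (simp add: good_def)
  ultimately have "card good \<le> word_count e n"
    using card_inj_on_le[of ?w good "feasible_words e n"] finite_feasible_words
    by (simp add: card_feasible_words)
  moreover have "error_prob noiseless_ternary R n e f dec * card ?M = card ?M - real (card good)"
  proof -
    have "error_prob noiseless_ternary R n e f dec * card ?M =
        (\<Sum>m\<in>?M. of_bool (dec (?w m) \<noteq> m))"
      using card_messages_pos[OF assms(2), of n]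
      by (simp add: error_prob_def message_error_prob_noiseless)
    also have "\<dots> = (\<Sum>m\<in>?M. 1 - of_bool (dec (?w m) = m))"
      by (intro sum.cong) auto
    also have "\<dots> = card ?M - real (card good)"
      using fin by (simp add: sum_subtractf good_def sum_of_bool_eq Int_def)
    finally show ?thesis .
  qed
  ultimately show ?thesis by (simp add: algebra_simps)
qed

text \<open>The messages are injected into the feasible words, and the decoder inverts the
  injection.\<close>

lemma zero_error_code_exists:
  assumes "n \<ge> 1" "R \<ge> 0"
    and e: "\<And>t. e t \<in> {0, 2}" and cost: "(\<Sum>t=1..n. e t) \<le> real n * \<Gamma>"
    and count: "2 powr (real n * R) \<le> real (word_count e n)"
  shows "\<exists>f dec. generic_charger_code noiseless_ternary \<Gamma> R n e f dec \<and>
     error_prob noiseless_ternary R n e f dec = 0"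
proof -
  let ?M = "messages R n"
  have "card ?M \<le> card (feasible_words e n)"
    using card_messages_le[of R n] count by (simp add: card_feasible_words)
  then obtain g where g: "g ` ?M \<subseteq> feasible_words e n" "inj_on g ?M"
    using card_le_inj[of ?M "feasible_words e n"] finite_feasible_words
    by (auto simp: messages_def)
  define f where "f = (\<lambda>t m (_::real list). g m ! (t - 1))"
  \<comment> \<open>The default answer has to be a message; 1 is one because
    \<open>R \<ge> 0\<close>.\<close>
  define dec where "dec = (\<lambda>ys. if ys \<in> g ` ?M then inv_into ?M g ys else 1)"
  have len: "length (g m) = n" "set (g m) \<subseteq> {0, 1, 2}" if "m \<in> ?M" for m
    using g(1) that words_at_level_bounds unfolding feasible_words_def by blast+
  have w: "prefix_list (codeword f e m) n = g m" if "m \<in> ?M" for m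
  proof -
    have "codeword f e m = (\<lambda>t. g m ! (t - 1))" by (simp add: codeword_def f_def fun_eq_iff)
    then show ?thesis using prefix_list_nth[OF len(1)[OF that]] by simp
  qed
  have "1 \<in> ?M"
    using card_messages_pos[OF assms(2), of n] by (simp add: messages_def)
  then have "dec ys \<in> ?M" for ys
    by (auto simp: dec_def inv_into_into)
  moreover have "f t m es \<in> {0, 1, 2}" if "t \<in> {1..n}" "m \<in> ?M" for t m es
  proof -
    have "f t m es \<in> set (g m)" unfolding f_def
      by (rule nth_mem) (use len(1)[OF that(2)] that(1) in auto)
    then show ?thesis using len(2)[OF that(2)] by blast
  qed
  moreover have "\<forall>m\<in>?M. \<forall>t\<in>{1..n}.
      real (codeword f e m t) \<le> min (battery noiseless_ternary e (codeword f e m) t + e t) 2"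
    using feasible_words_iff[of n e, OF e] g(1) w by blast
  ultimately have "generic_charger_code noiseless_ternary \<Gamma> R n e f dec"
    using assms(1) cost e by (auto simp: generic_charger_code_def field_simps)
  moreover have "error_prob noiseless_ternary R n e f dec = 0"
    using g(2) w by (simp add: error_prob_def message_error_prob_noiseless dec_def)
  ultimately show ?thesis by blast
qed

text \<open>Filler for short lengths, since achievability demands some code for every
  \<open>n \<ge> 1\<close>. Never charging and always sending 0 respects any budget
  \<open>\<Gamma> \<ge> 0\<close>.\<close>

lemma code_exists:
  assumes "\<Gamma> \<ge> 0" "R \<ge> 0"
  shows "\<exists>f dec. generic_charger_code noiseless_ternary \<Gamma> R n (\<lambda>_. 0) f dec"
proof -
  have "battery noiseless_ternary (\<lambda>_. 0) (\<lambda>_. 0) t = 2" for t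
    by (induction t rule: induct_nat_012) auto
  moreover have "codeword (\<lambda>_ _ _. 0::nat) e m = (\<lambda>_. 0)" for e and m
    by (simp add: codeword_def fun_eq_iff)
  moreover have "1 \<in> messages R n"
    using card_messages_pos[OF assms(2), of n] by (simp add: messages_def)
  ultimately have "generic_charger_code noiseless_ternary \<Gamma> R n (\<lambda>_. 0) (\<lambda>_ _ _. 0) (\<lambda>_. 1)"
    using assms by (simp add: generic_charger_code_def)
  then show ?thesis by blast
qed

text \<open>Zero error from some length on suffices; \<open>code_exists\<close> fills the finitely
  many shorter lengths.\<close>

lemma generic_achievableI:
  assumes "\<Gamma> \<ge> 0" "R \<ge> 0"
    and ev: "eventually (\<lambda>n. \<exists>e. (\<forall>t. e t \<in> {0, 2}) \<and> (\<Sum>t=1..n. e t) \<le> real n * \<Gamma> \<and>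
        2 powr (real n * R) \<le> real (word_count e n)) sequentially"
  shows "generic_achievable noiseless_ternary \<Gamma> R"
proof -
  obtain n0 where n0: "\<And>n. n \<ge> n0 \<Longrightarrow> \<exists>e. (\<forall>t. e t \<in> {0, 2}) \<and>
      (\<Sum>t=1..n. e t) \<le> real n * \<Gamma> \<and> 2 powr (real n * R) \<le> real (word_count e n)"
    using ev unfolding eventually_sequentially by blast
  have "\<exists>e f dec. generic_charger_code noiseless_ternary \<Gamma> R n e f dec \<and>
      (n \<ge> n0 \<longrightarrow> error_prob noiseless_ternary R n e f dec = 0)" if "n \<ge> 1" for n
  proof (cases "n \<ge> n0")
    case True
    then show ?thesis using n0[OF True] zero_error_code_exists[OF that assms(2)] by blast
  next
    case False
    then show ?thesis using code_exists[OF assms(1,2)] by blast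
  qed
  then obtain e f dec where code:
    "\<And>n. n \<ge> 1 \<Longrightarrow> generic_charger_code noiseless_ternary \<Gamma> R n (e n) (f n) (dec n)"
    "\<And>n. n \<ge> 1 \<Longrightarrow> n \<ge> n0 \<Longrightarrow> error_prob noiseless_ternary R n (e n) (f n) (dec n) = 0"
    by metis
  have "(\<lambda>n. error_prob noiseless_ternary R n (e n) (f n) (dec n)) \<longlonglongrightarrow> 0"
    by (rule tendsto_eventually, rule eventually_sequentiallyI[of "max 1 n0"]) (simp add: code(2))
  with code(1) assms(2) show ?thesis unfolding generic_achievable_def by blast
qed

section \<open>Concavity of the logarithmic word count\<close>

text \<open>The line through the points \<open>l\<close> and \<open>l + 1\<close> of the graph of \<open>log 2 \<circ> block_words\<close>.\<close>

definition tangent_slope :: "nat \<Rightarrow> real" where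
  "tangent_slope l = log 2 (block_words (Suc l)) - log 2 (block_words l)"

definition tangent_intercept :: "nat \<Rightarrow> real" where
  "tangent_intercept l = log 2 (block_words l) - real l * tangent_slope l"

text \<open>The ratio of consecutive counts is \<open>(l + 3) / (l + 1)\<close>. In this form it
  visibly decreases to 1, which yields both the concavity and the limit of the slopes.\<close>

lemma tangent_slope_eq: "tangent_slope l = log 2 (1 + 2 / (real l + 1))"
proof -
  have "tangent_slope l = log 2 (real (block_words (Suc l)) / real (block_words l))"
    unfolding tangent_slope_def using block_words_pos[of l] block_words_pos[of "Suc l"]
    by (intro log_divide_pos[symmetric]) auto
  also have "real (block_words (Suc l)) / real (block_words l) = 1 + 2 / (real l + 1)"
  proof -
    have "real l + 1 \<noteq> 0" "real l + 2 \<noteq> 0" by linarith+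
    then show ?thesis unfolding block_words_real by (simp add: divide_simps)
  qed
  finally show ?thesis .
qed

lemma tangent_slope_antimono: "l \<le> l' \<Longrightarrow> tangent_slope l' \<le> tangent_slope l"
  unfolding tangent_slope_eq by (intro log_mono add_left_mono divide_left_mono) (auto simp: add_pos_nonneg)

lemma tangent_slope_tendsto_0: "tangent_slope \<longlonglongrightarrow> 0"
proof -
  have "(\<lambda>l. 1 + 2 / (real l + 1)) \<longlonglongrightarrow> 1 + 0"
    using tendsto_add[OF tendsto_const tendsto_mult_right_zero[OF LIMSEQ_inverse_real_of_nat, of 2], of 1]
    by (simp add: divide_inverse add.commute)
  then have "(\<lambda>l. log 2 (1 + 2 / (real l + 1))) \<longlonglongrightarrow> log 2 1"
    by (intro tendsto_log) auto
  then show ?thesis unfolding tangent_slope_eq[abs_def] by simp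
qed

text \<open>Walking up from \<open>l\<close>, each increment is at most
  \<open>tangent_slope l\<close>; walking down, each decrement is at least that. Either way the
  graph stays below the line.\<close>

lemma log_block_words_le_tangent:
  "log 2 (block_words j) \<le> tangent_intercept l + tangent_slope l * real j"
proof -
  have step: "log 2 (block_words (Suc k)) = log 2 (block_words k) + tangent_slope k" for k
    by (simp add: tangent_slope_def)
  show ?thesis
  proof (cases "l \<le> j")
    case True
    then show ?thesis
    proof (induction j rule: dec_induct)
      case base
      then show ?case by (simp add: tangent_intercept_def)
    next
      case (step k)
      with tangent_slope_antimono[of l k] show ?case
        unfolding \<open>\<And>k. log 2 (block_words (Suc k)) = _\<close> by (simp add: algebra_simps)
    qed
  next
    case False
    then have "j \<le> l" by simp
    then show ?thesis
    proof (induction j rule: inc_induct)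
      case base
      then show ?case by (simp add: tangent_intercept_def)
    next
      case (step k)
      with tangent_slope_antimono[of k l] show ?case
        unfolding \<open>\<And>k. log 2 (block_words (Suc k)) = _\<close> by (simp add: algebra_simps)
    qed
  qed
qed

text \<open>At 0 the line lies above \<open>log 2 (block_words 0) = 0\<close>. The sign allows the
  cost constraint to be inserted into the converse.\<close>

lemma tangent_intercept_nonneg: "tangent_intercept l \<ge> 0"
  using log_block_words_le_tangent[of 0 l] by simp

section \<open>The converse\<close>

lemma settled_words_pos: "settled_words e n > 0"
  by (induction n) (auto simp: block_words_pos)

lemma log_word_count_settled:
  "log 2 (word_count e n) = log 2 (settled_words e n) + log 2 (block_words (age e n))"
  unfolding word_count_def of_nat_mult
  using settled_words_pos[of e n] block_words_pos[of "age e n"] by (intro log_mult_pos) auto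

text \<open>Each charge closes one gap, the first one closing the stretch from the start, and the
  closed gaps have total length \<open>n - age e n\<close>. The tangent bound is summed over them;
  half the total energy is the number of charges.\<close>

lemma log_settled_words_le:
  assumes "\<And>t. t \<in> {1..n} \<Longrightarrow> e t \<in> {0, 2}"
  shows "log 2 (settled_words e n) \<le>
    tangent_intercept l * ((\<Sum>t=1..n. e t) / 2) + tangent_slope l * (real n - real (age e n))"
  using assms
proof (induction n)
  case 0
  then show ?case by simp
next
  case (Suc n)
  then have IH: "log 2 (settled_words e n) \<le>
    tangent_intercept l * ((\<Sum>t=1..n. e t) / 2) + tangent_slope l * (real n - real (age e n))"
    by simp
  show ?case
  proof (cases "e (Suc n) = 2")
    case True
    then have "log 2 (settled_words e (Suc n)) =
        log 2 (settled_words e n) + log 2 (block_words (age e n))"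
      using log_word_count_settled[of e n] by (simp add: word_count_def)
    also have "\<dots> \<le> tangent_intercept l * ((\<Sum>t=1..n. e t) / 2)
        + tangent_slope l * (real n - real (age e n))
        + (tangent_intercept l + tangent_slope l * real (age e n))"
      by (rule add_mono[OF IH log_block_words_le_tangent])
    finally show ?thesis using True by (simp add: algebra_simps add_divide_distrib)
  next
    case False
    then have "e (Suc n) = 0" using Suc.prems[of "Suc n"] by simp
    with IH show ?thesis by simp
  qed
qed

text \<open>The gap still open at time \<open>n\<close> has length \<open>age e n\<close> and adds
  one more intercept.\<close>

lemma log_word_count_le:
  assumes "\<And>t. t \<in> {1..n} \<Longrightarrow> e t \<in> {0, 2}"
  shows "log 2 (word_count e n) \<le>
    tangent_intercept l * ((\<Sum>t=1..n. e t) / 2 + 1) + tangent_slope l * real n"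
proof -
  have "log 2 (word_count e n) \<le> tangent_intercept l * ((\<Sum>t=1..n. e t) / 2)
      + tangent_slope l * (real n - real (age e n))
      + (tangent_intercept l + tangent_slope l * real (age e n))"
    unfolding log_word_count_settled
    using add_mono[OF log_settled_words_le[of n e l] log_block_words_le_tangent] assms by blast
  then show ?thesis by (simp add: algebra_simps)
qed

text \<open>Once the error is below 1/2, at least half of the messages have distinct feasible words.
  The bounded corrections disappear on division by \<open>n\<close>.\<close>

lemma generic_achievable_le:
  assumes ach: "generic_achievable noiseless_ternary \<Gamma> R"
  shows "R \<le> tangent_intercept l * (\<Gamma> / 2) + tangent_slope l"
proof (rule ccontr)
  let ?a = "tangent_intercept l" and ?b = "tangent_slope l"
  define \<epsilon> where "\<epsilon> = R - (?a * (\<Gamma> / 2) + ?b)"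
  assume "\<not> ?thesis"
  then have \<epsilon>: "\<epsilon> > 0" by (simp add: \<epsilon>_def)
  obtain e f dec where R: "R \<ge> 0" and code:
    "\<And>n. n \<ge> 1 \<Longrightarrow> generic_charger_code noiseless_ternary \<Gamma> R n (e n) (f n) (dec n)"
    and lim: "(\<lambda>n. error_prob noiseless_ternary R n (e n) (f n) (dec n)) \<longlonglongrightarrow> 0"
    using ach unfolding generic_achievable_def by blast
  have "eventually (\<lambda>n. error_prob noiseless_ternary R n (e n) (f n) (dec n) < 1 / 2) sequentially"
    using lim by (rule order_tendstoD) simp
  \<comment> \<open>The 2 is \<open>log 2 4\<close>: one factor 2 for rounding the number of
    messages, one for the error. The term \<open>?a\<close> pays for the open gap.\<close>
  moreover have "eventually (\<lambda>n. real n > (?a + 2) / \<epsilon>) sequentially"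
    using filterlim_real_sequentially unfolding filterlim_at_top_dense by blast
  ultimately have "eventually (\<lambda>n. error_prob noiseless_ternary R n (e n) (f n) (dec n) < 1 / 2 \<and>
      real n > (?a + 2) / \<epsilon> \<and> n \<ge> 1) sequentially"
    using eventually_ge_at_top[of 1] by eventually_elim simp
  then obtain n where err: "error_prob noiseless_ternary R n (e n) (f n) (dec n) < 1 / 2"
    and n: "real n > (?a + 2) / \<epsilon>" "n \<ge> 1"
    using eventually_happens'[OF sequentially_bot] by blast
  let ?M = "real (card (messages R n))"
  have "1 / 2 * ?M \<le> (1 - error_prob noiseless_ternary R n (e n) (f n) (dec n)) * ?M"
    using err by (intro mult_right_mono) auto
  also have "\<dots> \<le> word_count (e n) n"
    by (rule successful_messages_le[OF code[OF n(2)] R])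
  finally have "2 powr (real n * R) \<le> 4 * real (word_count (e n) n)"
    using card_messages_ge[OF R, of n] by linarith
  moreover have "2 powr (real n * R - 2) = 2 powr (real n * R) / 4"
    by (simp add: powr_diff)
  ultimately have "2 powr (real n * R - 2) \<le> real (word_count (e n) n)" by linarith
  moreover have pos: "0 < real (word_count (e n) n)"
    by (simp add: word_count_def settled_words_pos block_words_pos)
  ultimately have "real n * R - 2 \<le> log 2 (word_count (e n) n)"
    by (simp add: le_log_iff)
  also have "\<dots> \<le> ?a * ((\<Sum>t=1..n. e n t) / 2 + 1) + ?b * real n"
    by (rule log_word_count_le) (use code[OF n(2)] in \<open>auto simp: generic_charger_code_def\<close>)
  also have "\<dots> \<le> ?a * (real n * \<Gamma> / 2 + 1) + ?b * real n"
    using code[OF n(2)] n(2)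
    by (intro add_right_mono mult_left_mono tangent_intercept_nonneg)
       (auto simp: generic_charger_code_def field_simps)
  finally have "real n * \<epsilon> \<le> ?a + 2" by (simp add: \<epsilon>_def algebra_simps)
  with n(1) \<epsilon> show False by (simp add: field_simps)
qed

section \<open>Charging sequences built from blocks\<close>

lemma word_count_cong:
  assumes "\<And>t. t \<in> {1..n} \<Longrightarrow> e t = e' t"
  shows "word_count e n = word_count e' n"
proof -
  have "settled_words e n = settled_words e' n \<and> age e n = age e' n"
    using assms by (induction n) auto
  then show ?thesis by (simp add: word_count_def)
qed

lemma word_count_mono: "n \<le> n' \<Longrightarrow> word_count e n \<le> word_count e n'"
proof (induction rule: dec_induct)
  case (step k)
  have "word_count e k \<le> word_count e (Suc k)"
    by (simp add: word_count_def algebra_simps)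
  with step show ?case by linarith
qed simp

text \<open>Silence of \<open>e\<close> after \<open>n\<close> is the invariant that makes blocks
  composable: a charge put at \<open>Suc n\<close> closes the current gap, and the silence after it
  opens a gap of length \<open>l\<close>.\<close>

lemma append_block:
  fixes e :: "nat \<Rightarrow> real"
  assumes "l \<ge> 1" "\<And>t. e t \<in> {0, 2}" "\<And>t. t > n \<Longrightarrow> e t = 0"
  shows "\<exists>e'. (\<forall>t. e' t \<in> {0, 2}) \<and> (\<forall>t>n + l. e' t = 0) \<and>
    (\<Sum>t=1..n + l. e' t) = (\<Sum>t=1..n. e t) + 2 \<and> word_count e' (n + l) = word_count e n * block_words l"
proof -
  define e' where "e' = e(Suc n := 2)"
  \<comment> \<open>The charged slot has age 1, so age \<open>l\<close> is reached at
    \<open>i = l - 1\<close>; this is where \<open>l \<ge> 1\<close> enters.\<close>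
  have "settled_words e' (n + Suc i) = word_count e' n \<and> age e' (n + Suc i) = Suc i" for i
    by (induction i) (auto simp: word_count_def e'_def assms(3))
  from this[of "l - 1"] have "word_count e' (n + l) = word_count e' n * block_words l"
    using assms(1) by (simp add: word_count_def)
  moreover have "word_count e' n = word_count e n"
    by (rule word_count_cong) (simp add: e'_def)
  moreover have "(\<Sum>t=1..n + l. e' t) = (\<Sum>t=1..n. e t) + 2"
  proof -
    have "(\<Sum>t=1..n + l. e' t) = (\<Sum>t=1..Suc n. e' t)"
      by (rule sum.mono_neutral_right) (use assms in \<open>auto simp: e'_def\<close>)
    also have "\<dots> = (\<Sum>t=1..n. e t) + 2" by (simp add: e'_def)
    finally show ?thesis .
  qed
  ultimately show ?thesis using assms
    by (intro exI[of _ e']) (auto simp: e'_def)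
qed

lemma append_blocks:
  fixes e :: "nat \<Rightarrow> real"
  assumes "l \<ge> 1" "\<And>t. e t \<in> {0, 2}" "\<And>t. t > n \<Longrightarrow> e t = 0"
  shows "\<exists>e'. (\<forall>t. e' t \<in> {0, 2}) \<and> (\<forall>t>n + k * l. e' t = 0) \<and>
    (\<Sum>t=1..n + k * l. e' t) = (\<Sum>t=1..n. e t) + 2 * real k \<and>
    word_count e' (n + k * l) = word_count e n * block_words l ^ k"
proof (induction k)
  case 0
  then show ?case using assms by auto
next
  case (Suc k)
  then obtain e1 where e1: "\<And>t. e1 t \<in> {0, 2}" "\<And>t. t > n + k * l \<Longrightarrow> e1 t = 0"
    "(\<Sum>t=1..n + k * l. e1 t) = (\<Sum>t=1..n. e t) + 2 * real k"
    "word_count e1 (n + k * l) = word_count e n * block_words l ^ k"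
    by blast
  have "n + Suc k * l = n + k * l + l" by simp
  with append_block[of l e1 "n + k * l", OF assms(1) e1(1,2)] e1(3,4) show ?case
    by (auto simp: algebra_simps)
qed

text \<open>The blocks of length \<open>l\<close> come first, then those of length
  \<open>l'\<close>. Slots left over up to \<open>n\<close> stay idle and cannot lower the
  count.\<close>

lemma two_block_lengths_sequence:
  assumes "l \<ge> 1" "l' \<ge> 1" "k * l + k' * l' \<le> n"
  shows "\<exists>e::nat \<Rightarrow> real. (\<forall>t. e t \<in> {0, 2}) \<and> (\<Sum>t=1..n. e t) = 2 * (real k + real k') \<and>
    block_words l ^ k * block_words l' ^ k' \<le> word_count e n"
proof -
  obtain e1 :: "nat \<Rightarrow> real" where e1: "\<And>t. e1 t \<in> {0, 2}" "\<And>t. t > k * l \<Longrightarrow> e1 t = 0"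
    "(\<Sum>t=1..k * l. e1 t) = 2 * real k" "word_count e1 (k * l) = block_words l ^ k"
    using append_blocks[of l "\<lambda>_. 0" 0 k] assms(1) by (auto simp: word_count_def)
  obtain e2 :: "nat \<Rightarrow> real" where e2: "\<And>t. e2 t \<in> {0, 2}" "\<And>t. t > k * l + k' * l' \<Longrightarrow> e2 t = 0"
    "(\<Sum>t=1..k * l + k' * l'. e2 t) = 2 * real k + 2 * real k'"
    "word_count e2 (k * l + k' * l') = block_words l ^ k * block_words l' ^ k'"
    using append_blocks[of l' e1 "k * l" k', OF assms(2) e1(1,2)] e1(3,4) by auto
  have "(\<Sum>t=1..n. e2 t) = (\<Sum>t=1..k * l + k' * l'. e2 t)"
    by (rule sum.mono_neutral_right) (use assms e2(2) in auto)
  with e2 word_count_mono[OF assms(3), of e2] show ?thesis by (intro exI[of _ e2]) auto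
qed

text \<open>The hypotheses on \<open>\<Gamma>\<close> place the mean gap \<open>2 / \<Gamma>\<close>
  between \<open>l\<close> and \<open>l + 1\<close>. A mixture of these two gaps then exhausts both
  the budget and the time, and attains the tangent bound up to rounding.\<close>

lemma generic_achievable_below_tangent:
  assumes l: "l \<ge> 1" and "real l * \<Gamma> \<le> 2" "2 \<le> real (Suc l) * \<Gamma>"
    and R: "0 \<le> R" "R < tangent_intercept l * (\<Gamma> / 2) + tangent_slope l"
  shows "generic_achievable noiseless_ternary \<Gamma> R"
proof (rule generic_achievableI)
  show "\<Gamma> \<ge> 0" using assms(3) by (smt (verit) mult_nonneg_nonpos of_nat_0_le_iff)
  \<comment> \<open>The numbers of blocks of lengths \<open>l\<close> and \<open>l + 1\<close> per unit of time; they solve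
    \<open>p + p' = \<Gamma> / 2\<close> and \<open>p l + p' (l + 1) = 1\<close>.\<close>
  define p p' where "p = real (Suc l) * \<Gamma> / 2 - 1" and "p' = 1 - real l * \<Gamma> / 2"
  have p: "p \<ge> 0" "p' \<ge> 0" "p + p' = \<Gamma> / 2" "p * real l + p' * real (Suc l) = 1"
    using assms by (auto simp: p_def p'_def algebra_simps)
  let ?L = "\<lambda>l. log 2 (block_words l)"
  have L: "?L l \<ge> 0" for l using block_words_pos[of l] by simp
  \<comment> \<open>\<open>V\<close> is the rate of this mixture. Both lengths lie on the line, so
    \<open>V\<close> equals the upper bound.\<close>
  define V where "V = p * ?L l + p' * ?L (Suc l)"
  have "?L l = tangent_intercept l + real l * tangent_slope l"
    "?L (Suc l) = tangent_intercept l + real (Suc l) * tangent_slope l"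
    by (simp_all add: tangent_intercept_def tangent_slope_def algebra_simps)
  then have "V = tangent_intercept l * (p + p') + tangent_slope l * (p * real l + p' * real (Suc l))"
    unfolding V_def by (simp add: algebra_simps)
  then have V: "R < V" using R(2) unfolding p by simp
  \<comment> \<open>Rounding the numbers of blocks down costs at most one block of each length,
    hence at most \<open>?L l + ?L (Suc l)\<close> in the exponent. For these \<open>n\<close> the
    slack \<open>n * (V - R)\<close> covers it.\<close>
  have "eventually (\<lambda>n. real n \<ge> (?L l + ?L (Suc l)) / (V - R)) sequentially"
    using filterlim_real_sequentially unfolding filterlim_at_top by blast
  then show "eventually (\<lambda>n. \<exists>e. (\<forall>t. e t \<in> {0, 2}) \<and> (\<Sum>t=1..n. e t) \<le> real n * \<Gamma> \<and>
        2 powr (real n * R) \<le> real (word_count e n)) sequentially"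
  proof eventually_elim
    case (elim n)
    define k k' where "k = nat \<lfloor>real n * p\<rfloor>" and "k' = nat \<lfloor>real n * p'\<rfloor>"
    have k: "real k \<le> real n * p" "real k' \<le> real n * p'"
      "real n * p - 1 \<le> real k" "real n * p' - 1 \<le> real k'"
      using p by (simp_all add: k_def k'_def)
    have "real (k * l + k' * Suc l) \<le> (real n * p) * real l + (real n * p') * real (Suc l)"
      unfolding of_nat_add of_nat_mult by (intro add_mono mult_right_mono k) auto
    also have "\<dots> = real n * (p * real l + p' * real (Suc l))" by (simp only: algebra_simps)
    finally have "k * l + k' * Suc l \<le> n" unfolding p mult_1_right of_nat_le_iff .
    then obtain e :: "nat \<Rightarrow> real" where e: "\<And>t. e t \<in> {0, 2}"
      "(\<Sum>t=1..n. e t) = 2 * (real k + real k')"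
      "block_words l ^ k * block_words (Suc l) ^ k' \<le> word_count e n"
      using two_block_lengths_sequence[of l "Suc l" k k' n] l by auto
    have "real k + real k' \<le> real n * (p + p')" using k by (simp add: algebra_simps)
    then have cost: "(\<Sum>t=1..n. e t) \<le> real n * \<Gamma>" unfolding e(2) p by simp
    have "?L l + ?L (Suc l) \<le> real n * (V - R)" using elim V by (simp add: field_simps)
    then have "real n * R \<le> (real n * p - 1) * ?L l + (real n * p' - 1) * ?L (Suc l)"
      by (simp add: V_def algebra_simps)
    also have "\<dots> \<le> real k * ?L l + real k' * ?L (Suc l)"
      by (intro add_mono mult_right_mono k L)
    finally have "2 powr (real n * R) \<le> 2 powr (real k * ?L l + real k' * ?L (Suc l))" by simp
    also have "\<dots> = (2 powr ?L l) powr k * (2 powr ?L (Suc l)) powr k'"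
      by (simp only: powr_add powr_powr mult.commute)
    also have "\<dots> = real (block_words l ^ k * block_words (Suc l) ^ k')"
      using block_words_pos[of l] block_words_pos[of "Suc l"]
      by (simp add: powr_realpow del: block_words_Suc)
    also have "\<dots> \<le> real (word_count e n)" using e(3) by (simp only: of_nat_le_iff)
    finally show ?case using e(1) cost by blast
  qed
qed (rule R(1))

section \<open>Values of the capacity\<close>

lemma generic_achievable_0: "\<Gamma> \<ge> 0 \<Longrightarrow> generic_achievable noiseless_ternary \<Gamma> 0"
proof (rule generic_achievableI)
  assume "\<Gamma> \<ge> 0"
  show "eventually (\<lambda>n. \<exists>e. (\<forall>t. e t \<in> {0, 2}) \<and> (\<Sum>t=1..n. e t) \<le> real n * \<Gamma> \<and>
        2 powr (real n * 0) \<le> real (word_count e n)) sequentially"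
  proof (intro always_eventually allI exI[of _ "\<lambda>_. 0"])
    fix n
    have "word_count (\<lambda>_. 0) n > 0" by (simp add: word_count_def settled_words_pos block_words_pos)
    with \<open>\<Gamma> \<ge> 0\<close> show "(\<forall>t. (0::real) \<in> {0, 2}) \<and> (\<Sum>t=1..n. 0) \<le> real n * \<Gamma> \<and>
        2 powr (real n * 0) \<le> real (word_count (\<lambda>_. 0) n)"
      by auto
  qed
qed auto

lemma generic_achievable_mono:
  assumes "generic_achievable c \<Gamma> R" "\<Gamma> \<le> \<Gamma>'"
  shows "generic_achievable c \<Gamma>' R"
proof -
  have "generic_charger_code c \<Gamma>' R n e f dec" if "generic_charger_code c \<Gamma> R n e f dec" for n e f dec
    using that assms(2) unfolding generic_charger_code_def by auto
  then show ?thesis using assms(1) unfolding generic_achievable_def by blast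
qed

lemma generic_capacity_eqI:
  assumes "generic_achievable noiseless_ternary \<Gamma> 0"
    and upper: "\<And>R. generic_achievable noiseless_ternary \<Gamma> R \<Longrightarrow> R \<le> V"
    and lower: "\<And>R. 0 \<le> R \<Longrightarrow> R < V \<Longrightarrow> generic_achievable noiseless_ternary \<Gamma> R"
  shows "generic_capacity noiseless_ternary \<Gamma> = V"
  unfolding generic_capacity_def
proof (rule cSup_eq_non_empty)
  fix y assume y: "\<And>R. R \<in> {R. generic_achievable noiseless_ternary \<Gamma> R} \<Longrightarrow> R \<le> y"
  then have "0 \<le> y" using assms(1) by blast
  show "V \<le> y"
  proof (rule ccontr)
    assume "\<not> V \<le> y"
    \<comment> \<open>The midpoint lies strictly between \<open>y\<close> and \<open>V\<close>, and
      \<open>0 \<le> y\<close> makes it nonnegative, so it is an achievable rate above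
      \<open>y\<close>.\<close>
    then have "(y + V) / 2 \<le> y" using \<open>0 \<le> y\<close> by (intro y CollectI lower) auto
    with \<open>\<not> V \<le> y\<close> show False by simp
  qed
qed (use assms in auto)

lemma capacity_noiseless_ternary:
  assumes "l \<ge> 1" "real l * \<Gamma> \<le> 2" "2 \<le> real (Suc l) * \<Gamma>"
  shows "generic_capacity noiseless_ternary \<Gamma> = tangent_intercept l * (\<Gamma> / 2) + tangent_slope l"
proof (rule generic_capacity_eqI)
  have "\<Gamma> \<ge> 0" using assms(3) by (smt (verit) mult_nonneg_nonpos of_nat_0_le_iff)
  then show "generic_achievable noiseless_ternary \<Gamma> 0" by (rule generic_achievable_0)
qed (use generic_achievable_le generic_achievable_below_tangent[OF assms] in auto)

text \<open>Gaps of the single length \<open>l\<close>: the line is evaluated where it meets the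
  graph.\<close>

lemma capacity_noiseless_ternary_inverse:
  assumes "l \<ge> 1"
  shows "generic_capacity noiseless_ternary (2 / real l) = log 2 (block_words l) / real l"
proof -
  have "generic_capacity noiseless_ternary (2 / real l) =
      tangent_intercept l * (2 / real l / 2) + tangent_slope l"
    using assms by (intro capacity_noiseless_ternary) (auto simp: field_simps)
  then show ?thesis using assms by (simp add: tangent_intercept_def field_simps)
qed

text \<open>From \<open>\<Gamma>1\<close> to \<open>\<Gamma>2\<close>, endpoints included, the
  capacity is the affine function given by the same \<open>l\<close>, so it interpolates its end
  values.\<close>

lemma capacity_noiseless_ternary_time_sharing:
  assumes "l \<ge> 1" "real l * \<Gamma> < 2" "2 < real (Suc l) * \<Gamma>"
  defines "\<Gamma>1 \<equiv> 2 / real (Suc l)" and "\<Gamma>2 \<equiv> 2 / real l"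
  defines "\<alpha> \<equiv> (\<Gamma>2 - \<Gamma>) / (\<Gamma>2 - \<Gamma>1)"
  shows "generic_capacity noiseless_ternary \<Gamma> =
    \<alpha> * generic_capacity noiseless_ternary \<Gamma>1 + (1 - \<alpha>) * generic_capacity noiseless_ternary \<Gamma>2"
proof -
  have eq: "generic_capacity noiseless_ternary G = tangent_intercept l * (G / 2) + tangent_slope l"
    if "G \<in> {\<Gamma>, \<Gamma>1, \<Gamma>2}" for G
  proof (rule capacity_noiseless_ternary)
    have "real l * \<Gamma>1 \<le> 2" "real (Suc l) * \<Gamma>1 = 2" "real l * \<Gamma>2 = 2" "2 \<le> real (Suc l) * \<Gamma>2"
      using assms(1) by (simp_all add: \<Gamma>1_def \<Gamma>2_def field_simps)
    then show "real l * G \<le> 2" "2 \<le> real (Suc l) * G"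
      using that assms(2,3) by auto
  qed (rule assms(1))
  have "\<Gamma>1 < \<Gamma>2"
    unfolding \<Gamma>1_def \<Gamma>2_def using assms(1) by (intro divide_strict_left_mono) auto
  then have "\<alpha> * (\<Gamma>2 - \<Gamma>1) = \<Gamma>2 - \<Gamma>" by (simp add: \<alpha>_def)
  then have "\<Gamma> = \<alpha> * \<Gamma>1 + (1 - \<alpha>) * \<Gamma>2" by (simp add: algebra_simps)
  then have "tangent_intercept l * (\<Gamma> / 2) + tangent_slope l =
      \<alpha> * (tangent_intercept l * (\<Gamma>1 / 2) + tangent_slope l)
      + (1 - \<alpha>) * (tangent_intercept l * (\<Gamma>2 / 2) + tangent_slope l)"
    by algebra
  then show ?thesis by (simp add: eq)
qed

text \<open>No single line suffices here: line \<open>l\<close> gives the bound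
  \<open>tangent_slope l\<close>, which is positive but tends to 0.\<close>

lemma capacity_noiseless_ternary_0: "generic_capacity noiseless_ternary 0 = 0"
proof (rule generic_capacity_eqI)
  fix R assume "generic_achievable noiseless_ternary 0 R"
  then have "R \<le> tangent_slope l" for l
    using generic_achievable_le[of 0 R l] by simp
  then show "R \<le> 0" using tangent_slope_tendsto_0 by (intro LIMSEQ_le_const) auto
qed (auto intro: generic_achievable_0)

text \<open>The converse uses the line for \<open>l = 0\<close>, with intercept 0 and slope
  \<open>log 2 3\<close>. The codes come from blocks of length 1, affordable already at budget
  2.\<close>

lemma capacity_noiseless_ternary_above_2:
  assumes "\<Gamma> \<ge> 2"
  shows "generic_capacity noiseless_ternary \<Gamma> = log 2 3"
proof (rule generic_capacity_eqI)
  show "generic_achievable noiseless_ternary \<Gamma> 0" using assms by (intro generic_achievable_0) simp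
next
  fix R assume "generic_achievable noiseless_ternary \<Gamma> R"
  from generic_achievable_le[OF this, of 0] show "R \<le> log 2 3"
    by (simp add: tangent_intercept_def tangent_slope_def)
next
  fix R :: real assume "0 \<le> R" "R < log 2 3"
  then have "generic_achievable noiseless_ternary 2 R"
    by (intro generic_achievable_below_tangent[of 1])
       (auto simp: tangent_intercept_def)
  then show "generic_achievable noiseless_ternary \<Gamma> R"
    using assms by (rule generic_achievable_mono)
qed

theorem proposition2:
  defines "C \<equiv> generic_capacity noiseless_ternary"
  shows "(\<forall>\<Gamma>::real. 0 < \<Gamma> \<and> \<Gamma> \<le> 2 \<and> (\<exists>l::nat. l \<ge> 1 \<and> \<Gamma> = 2 / real l) \<longrightarrow>
            C \<Gamma> = \<Gamma> / 2 * log 2 ((\<Gamma> + 1) * (\<Gamma> + 2) / \<Gamma>\<^sup>2)) \<and>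
         (\<forall>\<Gamma>::real. 0 < \<Gamma> \<and> \<Gamma> \<le> 2 \<and> \<not> (\<exists>l::nat. l \<ge> 1 \<and> \<Gamma> = 2 / real l) \<longrightarrow>
            (let \<Gamma>1 = 2 / real_of_int \<lceil>2 / \<Gamma>\<rceil>;
                 \<Gamma>2 = 2 / real_of_int \<lfloor>2 / \<Gamma>\<rfloor>;
                 \<alpha> = (\<Gamma>2 - \<Gamma>) / (\<Gamma>2 - \<Gamma>1)
             in C \<Gamma> = \<alpha> * C \<Gamma>1 + (1 - \<alpha>) * C \<Gamma>2)) \<and>
         C 0 = 0 \<and>
         (\<forall>\<Gamma>::real. \<Gamma> > 2 \<longrightarrow> C \<Gamma> = log 2 3)"
proof (intro conjI allI impI)
  fix \<Gamma> :: real
  assume "0 < \<Gamma> \<and> \<Gamma> \<le> 2 \<and> (\<exists>l::nat. l \<ge> 1 \<and> \<Gamma> = 2 / real l)"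
  then obtain l :: nat where l: "l \<ge> 1" "\<Gamma> = 2 / real l" by blast
  have "(\<Gamma> + 1) * (\<Gamma> + 2) / \<Gamma>\<^sup>2 = real (block_words l)"
  proof -
    have *: "real l = 2 / \<Gamma>" "\<Gamma> \<noteq> 0" using l by auto
    show ?thesis
      unfolding block_words_real *(1) using *(2) by (simp add: field_simps power2_eq_square)
  qed
  then show "C \<Gamma> = \<Gamma> / 2 * log 2 ((\<Gamma> + 1) * (\<Gamma> + 2) / \<Gamma>\<^sup>2)"
    using l capacity_noiseless_ternary_inverse[of l] by (simp add: C_def)
next
  fix \<Gamma> :: real
  assume \<Gamma>: "0 < \<Gamma> \<and> \<Gamma> \<le> 2 \<and> \<not> (\<exists>l::nat. l \<ge> 1 \<and> \<Gamma> = 2 / real l)"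
  define l where "l = nat \<lfloor>2 / \<Gamma>\<rfloor>"
  have "1 \<le> 2 / \<Gamma>" using \<Gamma> by (simp add: field_simps)
  then have "1 \<le> \<lfloor>2 / \<Gamma>\<rfloor>" by (simp only: one_le_floor)
  then have fl: "\<lfloor>2 / \<Gamma>\<rfloor> = int l" and l: "l \<ge> 1"
    unfolding l_def by linarith+
  \<comment> \<open>The quotient is not an integer, so its ceiling is \<open>l + 1\<close>, and
    \<open>\<Gamma>\<close> lies strictly between the two neighbours of the form
    \<open>2 / l\<close>.\<close>
  have "2 / \<Gamma> \<noteq> real l"
  proof
    assume "2 / \<Gamma> = real l"
    then have "\<Gamma> = 2 / real l" using \<Gamma> l by (simp add: field_simps)
    with \<Gamma> l show False by blast
  qed
  moreover have "real l \<le> 2 / \<Gamma>" "2 / \<Gamma> < real l + 1" using fl by linarith+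
  ultimately have bounds: "real l < 2 / \<Gamma>" "2 / \<Gamma> < real l + 1" by auto
  then have ceil: "\<lceil>2 / \<Gamma>\<rceil> = int (Suc l)" by (intro ceiling_unique) auto
  have "real l * \<Gamma> < 2" "2 < real (Suc l) * \<Gamma>" using bounds \<Gamma> by (auto simp: field_simps)
  from capacity_noiseless_ternary_time_sharing[OF l this]
  show "let \<Gamma>1 = 2 / real_of_int \<lceil>2 / \<Gamma>\<rceil>;
            \<Gamma>2 = 2 / real_of_int \<lfloor>2 / \<Gamma>\<rfloor>;
            \<alpha> = (\<Gamma>2 - \<Gamma>) / (\<Gamma>2 - \<Gamma>1)
        in C \<Gamma> = \<alpha> * C \<Gamma>1 + (1 - \<alpha>) * C \<Gamma>2"
    unfolding Let_def C_def fl ceil of_int_of_nat_eq .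
qed (auto simp: C_def capacity_noiseless_ternary_0 capacity_noiseless_ternary_above_2)

end
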